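(* For all $a,b>0$ with $a\ne b$, $$\left(\frac{A+G}{2}\right)^{1/\ln2}A^{1-1/\ln2}<X<\left(\frac{A+G}{2}\right)^{4/3}A^{-1/3}$$ and $$\left(\frac{Q+A}{2}\right)^{1/\ln2}Q^{1-1/\ln2}<B<\left(\frac{Q+A}{2}\right)^{4/3}Q^{-1/3}.$$
   Context: For $a,b>0$ with $a\neq b$: $Q=\sqrt{\frac{a^2+b^2}{2}}$, $A=\frac{a+b}{2}$, $G=\sqrt{ab}$, $P=\frac{a-b}{2\arcsin\frac{a-b}{a+b}}$ (first Seiffert mean), $T=\frac{a-b}{2\arctan\frac{a-b}{a+b}}$ (second Seiffert mean), $X=A e^{G/P-1}$, and $B=Q e^{A/T-1}$. *)

theory Defs
  imports Complex_Main
begin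

definition quadratic_mean :: "real \<Rightarrow> real \<Rightarrow> real" where
  "quadratic_mean a b = sqrt ((a\<^sup>2 + b\<^sup>2) / 2)"

definition arith_mean :: "real \<Rightarrow> real \<Rightarrow> real" where
  "arith_mean a b = (a + b) / 2"

definition geom_mean :: "real \<Rightarrow> real \<Rightarrow> real" where
  "geom_mean a b = sqrt (a * b)"

text \<open>The two Seiffert means are meant for distinct positive arguments only; on the diagonal
  the formulas below give the junk value 0 by the convention on division by zero.\<close>

definition seiffert_mean1 :: "real \<Rightarrow> real \<Rightarrow> real" where
  "seiffert_mean1 a b = (a - b) / (2 * arcsin ((a - b) / (a + b)))"

definition seiffert_mean2 :: "real \<Rightarrow> real \<Rightarrow> real" where
  "seiffert_mean2 a b = (a - b) / (2 * arctan ((a - b) / (a + b)))"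

definition X_mean :: "real \<Rightarrow> real \<Rightarrow> real" where
  "X_mean a b = arith_mean a b * exp (geom_mean a b / seiffert_mean1 a b - 1)"

definition B_mean :: "real \<Rightarrow> real \<Rightarrow> real" where
  "B_mean a b = quadratic_mean a b * exp (arith_mean a b / seiffert_mean2 a b - 1)"

end

theory Submission
  imports Defs "HOL-Real_Asymp.Real_Asymp"
begin

text \<open>With \<open>sin t = (a - b) / (a + b)\<close> for the first pair of inequalities and
  \<open>tan t = (a - b) / (a + b)\<close> for the second one, both become
  \<open>ln ((1 + cos t) / 2) / ln 2 < t cot t - 1 < 4/3 ln ((1 + cos t) / 2)\<close> for
  \<open>0 < \<bar>t\<bar> < pi/2\<close>.  The difference \<open>t cot t - 1 - k ln ((1 + cos t) / 2)\<close> tends to \<open>0\<close> at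
  \<open>0\<close>, and its derivative is \<open>- g t / sin\<^sup>2 t\<close> with \<open>g t = t - k sin t + (k - 1) sin t cos t\<close> and
  \<open>g' t = (1 - cos t) (2 - k - 2 (k - 1) cos t)\<close>.  For \<open>k = 4/3\<close> the function \<open>g\<close> is increasing,
  hence positive.  For \<open>k = 1 / ln 2\<close> the difference also vanishes at \<open>pi/2\<close>, and the second
  factor of \<open>g'\<close> is increasing, so \<open>g\<close> changes sign at most once, from negative to positive.\<close>

definition cot_log_diff :: "real \<Rightarrow> real \<Rightarrow> real" where
  "cot_log_diff k t = t * cos t / sin t - 1 - k * ln ((1 + cos t) / 2)"

definition slope_numerator :: "real \<Rightarrow> real \<Rightarrow> real" where
  "slope_numerator k t = t - k * sin t + (k - 1) * sin t * cos t"

lemma slope_numerator_deriv: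
  "(slope_numerator k has_real_derivative (1 - cos t) * (2 - k - 2 * (k - 1) * cos t)) (at t)"
proof -
  have "sin t * sin t = 1 - cos t * cos t"
    using sin_cos_squared_add[of t] by (simp add: power2_eq_square)
  then have "1 - k * cos t + (k - 1) * (cos t * cos t - sin t * sin t)
      = (1 - cos t) * (2 - k - 2 * (k - 1) * cos t)"
    by (simp only:) (simp add: algebra_simps)
  then show ?thesis
    unfolding slope_numerator_def[abs_def]
    by (auto intro!: derivative_eq_intros simp: algebra_simps)
qed

lemma cot_log_diff_deriv:
  assumes "0 < t" "t < pi"
  shows "(cot_log_diff k has_real_derivative - slope_numerator k t / (sin t)\<^sup>2) (at t)"
proof -
  have s: "sin t > 0" using assms by (simp add: sin_gt_zero)
  have "cos t > cos pi" using assms by (intro cos_monotone_0_pi) auto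
  then have c: "1 + cos t > 0" by simp
  have sq: "sin t * sin t = (1 + cos t) * (1 - cos t)"
    using sin_cos_squared_add[of t] by (simp add: power2_eq_square algebra_simps)
  \<comment> \<open>Both quotients equal \<open>tan (t/2)\<close>; the second form lets the
    derivative of the logarithm join the quotient-rule term over the denominator
    \<open>sin t * sin t\<close>.\<close>
  have half: "sin t / (1 + cos t) = (1 - cos t) / sin t"
    using s c sq by (simp add: field_simps)
  have "((cos t - t * sin t) * sin t - t * cos t * cos t) / (sin t * sin t)
      + k * (sin t / (1 + cos t)) = - slope_numerator k t / (sin t)\<^sup>2"
  proof -
    have "(cos t - t * sin t) * sin t - t * cos t * cos t = cos t * sin t - t"
      using sin_cos_squared_add[of t] by algebra
    then show ?thesis
      unfolding half slope_numerator_def using s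
      by (simp add: divide_simps power2_eq_square) (simp add: algebra_simps)
  qed
  then show ?thesis
    unfolding cot_log_diff_def[abs_def]
    using s c by (auto intro!: derivative_eq_intros simp: algebra_simps)
qed

text \<open>A limit replaces the value at the origin: division by zero makes
  \<open>cot_log_diff k 0\<close> equal to -1, so monotonicity arguments cannot start at 0
  itself.\<close>

lemma cot_log_diff_tendsto_0: "(cot_log_diff k \<longlongrightarrow> 0) (at_right 0)"
proof -
  have "((\<lambda>t::real. t * cos t / sin t - 1) \<longlongrightarrow> 0) (at_right 0)"
    by real_asymp
  moreover have "((\<lambda>t::real. k * ln ((1 + cos t) / 2)) \<longlongrightarrow> k * ln ((1 + cos 0) / 2)) (at_right 0)"
    by (intro tendsto_intros) auto
  ultimately show ?thesis
    unfolding cot_log_diff_def[abs_def] using tendsto_diff by fastforce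
qed

lemma cot_log_diff_neg:
  assumes "0 < x" "x < pi" and pos: "\<And>y. 0 < y \<Longrightarrow> y < x \<Longrightarrow> slope_numerator k y > 0"
  shows "cot_log_diff k x < 0"
proof -
  have dec: "cot_log_diff k z < cot_log_diff k y" if "0 < y" "y < z" "z \<le> x" for y z
  proof (rule DERIV_neg_imp_decreasing_open[OF that(2)])
    fix u assume u: "y < u" "u < z"
    then have "slope_numerator k u / (sin u)\<^sup>2 > 0"
      using that assms pos[of u] sin_gt_zero[of u] by simp
    then show "\<exists>d. (cot_log_diff k has_real_derivative d) (at u) \<and> d < 0"
      using cot_log_diff_deriv[of u k] u that assms by fastforce
  next
    show "continuous_on {y..z} (cot_log_diff k)"
      using that assms
      by (intro continuous_at_imp_continuous_on ballI DERIV_isCont[OF cot_log_diff_deriv]) auto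
  qed
  \<comment> \<open>The limit yields only a weak inequality, so it is applied at \<open>x/2\<close>;
    the strict decrease from \<open>x/2\<close> to \<open>x\<close> then restores
    strictness.\<close>
  have "eventually (\<lambda>y. cot_log_diff k (x/2) \<le> cot_log_diff k y) (at_right 0)"
    unfolding eventually_at_right_field using assms
    by (intro exI[of _ "x/2"]) (auto intro!: less_imp_le dec)
  from tendsto_lowerbound[OF cot_log_diff_tendsto_0 this]
  have "cot_log_diff k (x/2) \<le> 0" by simp
  then show ?thesis using dec[of "x/2" x] assms by simp
qed

lemma cot_log_diff_pos:
  assumes "0 < x" "x < pi" and neg: "\<And>y. 0 < y \<Longrightarrow> y < x \<Longrightarrow> slope_numerator k y < 0"
  shows "cot_log_diff k x > 0"
proof -
  have inc: "cot_log_diff k y < cot_log_diff k z" if "0 < y" "y < z" "z \<le> x" for y z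
  proof (rule DERIV_pos_imp_increasing_open[OF that(2)])
    fix u assume u: "y < u" "u < z"
    then have "slope_numerator k u / (sin u)\<^sup>2 < 0"
      using that assms neg[of u] sin_gt_zero[of u] by (simp add: divide_neg_pos)
    then show "\<exists>d. (cot_log_diff k has_real_derivative d) (at u) \<and> d > 0"
      using cot_log_diff_deriv[of u k] u that assms by fastforce
  next
    show "continuous_on {y..z} (cot_log_diff k)"
      using that assms
      by (intro continuous_at_imp_continuous_on ballI DERIV_isCont[OF cot_log_diff_deriv]) auto
  qed
  have "eventually (\<lambda>y. cot_log_diff k y \<le> cot_log_diff k (x/2)) (at_right 0)"
    unfolding eventually_at_right_field using assms
    by (intro exI[of _ "x/2"]) (auto intro!: less_imp_le inc)
  from tendsto_upperbound[OF cot_log_diff_tendsto_0 this]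
  have "cot_log_diff k (x/2) \<ge> 0" by simp
  then show ?thesis using inc[of "x/2" x] assms by simp
qed

text \<open>This is the single sign change, obtained without locating a zero. Since
  \<open>slope_numerator k 0 = 0\<close>, the mean value theorem gives a point \<open>\<xi>\<close>
  before \<open>x\<close> with nonnegative derivative. There the factor
  \<open>2 - k - 2 * (k - 1) * cos \<xi>\<close> is nonnegative, and it grows as the cosine falls,
  so the function increases strictly from \<open>x\<close> on.\<close>

lemma slope_numerator_pos_after_nonneg:
  assumes k: "k > 1" and x: "0 < x" "x < y" "y \<le> pi" and nonneg: "slope_numerator k x \<ge> 0"
  shows "slope_numerator k y > 0"
proof -
  obtain \<xi> where \<xi>: "0 < \<xi>" "\<xi> < x"
    and eq: "slope_numerator k x - slope_numerator k 0
      = (x - 0) * ((1 - cos \<xi>) * (2 - k - 2 * (k - 1) * cos \<xi>))"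
    using MVT2[OF x(1) slope_numerator_deriv] by blast
  have cos_lt_1: "cos u < 1" if "0 < u" "u \<le> pi" for u
    using cos_monotone_0_pi[of 0 u] that by simp
  have "(1 - cos \<xi>) * (2 - k - 2 * (k - 1) * cos \<xi>) \<ge> 0"
    using eq nonneg x by (simp add: slope_numerator_def zero_le_mult_iff)
  then have q: "2 - k - 2 * (k - 1) * cos \<xi> \<ge> 0"
    using cos_lt_1[of \<xi>] \<xi> x by (simp add: zero_le_mult_iff)
  have "slope_numerator k x < slope_numerator k y"
  proof (rule DERIV_pos_imp_increasing_open[OF x(2)])
    fix u assume u: "x < u" "u < y"
    then have "cos u < cos \<xi>" using \<xi> x by (intro cos_monotone_0_pi) auto
    then have "2 * (k - 1) * cos u < 2 * (k - 1) * cos \<xi>" using k by simp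
    then have "(1 - cos u) * (2 - k - 2 * (k - 1) * cos u) > 0"
      using q cos_lt_1[of u] u x by (intro mult_pos_pos) auto
    then show "\<exists>d. (slope_numerator k has_real_derivative d) (at u) \<and> d > 0"
      using slope_numerator_deriv by blast
  next
    show "continuous_on {x..y} (slope_numerator k)"
      by (intro continuous_at_imp_continuous_on ballI DERIV_isCont[OF slope_numerator_deriv])
  qed
  then show ?thesis using nonneg by simp
qed

lemma cot_log_diff_four_thirds_neg:
  assumes "0 < x" "x < pi"
  shows "cot_log_diff (4/3) x < 0"
proof (rule cot_log_diff_neg[OF assms])
  fix y assume y: "0 < y" "y < x"
  have "slope_numerator (4/3) 0 < slope_numerator (4/3) y"
  proof (rule DERIV_pos_imp_increasing_open[OF y(1)])
    fix u assume u: "0 < u" "u < y"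
    then have "cos u < 1" using cos_monotone_0_pi[of 0 u] y assms by simp
    \<comment> \<open>For \<open>k = 4/3\<close> the second factor is
      \<open>2/3 * (1 - cos u)\<close>: this is the \<open>k\<close> for which that factor vanishes
      at 0.\<close>
    then have "(1 - cos u) * (2 - 4/3 - 2 * (4/3 - 1) * cos u) > 0"
      by (intro mult_pos_pos) auto
    then show "\<exists>d. (slope_numerator (4/3) has_real_derivative d) (at u) \<and> d > 0"
      using slope_numerator_deriv by blast
  next
    show "continuous_on {0..y} (slope_numerator (4/3))"
      by (intro continuous_at_imp_continuous_on ballI DERIV_isCont[OF slope_numerator_deriv])
  qed
  then show "slope_numerator (4/3) y > 0" by (simp add: slope_numerator_def)
qed

text \<open>If the slope numerator is nonnegative at \<open>x\<close>, it is positive from there to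
  \<open>pi/2\<close>, and the difference falls strictly to its value 0 at \<open>pi/2\<close>.
  Otherwise it is negative on all of \<open>(0, x)\<close>, and the difference rises from its limit
  0.\<close>

lemma cot_log_diff_inverse_ln2_pos:
  assumes "0 < x" "x < pi/2"
  shows "cot_log_diff (1 / ln 2) x > 0"
proof -
  define k where "k = 1 / ln (2::real)"
  have k: "k > 1" using ln_2_less_1 by (simp add: k_def)
  have "cot_log_diff k x > 0"
  proof (cases "slope_numerator k x \<ge> 0")
    case True
    have "cot_log_diff k (pi/2) < cot_log_diff k x"
    proof (rule DERIV_neg_imp_decreasing_open[OF assms(2)])
      fix u assume u: "x < u" "u < pi/2"
      then have "slope_numerator k u > 0"
        using slope_numerator_pos_after_nonneg[OF k assms(1) u(1) _ True] u(2) pi_gt_zero by linarith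
      then have "slope_numerator k u / (sin u)\<^sup>2 > 0"
        using u assms sin_gt_zero[of u] by simp
      then show "\<exists>d. (cot_log_diff k has_real_derivative d) (at u) \<and> d < 0"
        using cot_log_diff_deriv[of u k] u assms by fastforce
    next
      show "continuous_on {x..pi/2} (cot_log_diff k)"
        using assms
        by (intro continuous_at_imp_continuous_on ballI DERIV_isCont[OF cot_log_diff_deriv]) auto
    qed
    \<comment> \<open>The value is \<open>k * ln 2 - 1\<close>, which determines the constant
      \<open>1 / ln 2\<close>.\<close>
    moreover have "cot_log_diff k (pi/2) = 0"
      by (simp add: cot_log_diff_def k_def ln_div)
    ultimately show ?thesis by simp
  next
    case False
    show ?thesis
    proof (rule cot_log_diff_pos)
      fix y assume y: "0 < y" "y < x"
      show "slope_numerator k y < 0"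
      proof (rule ccontr)
        assume "\<not> slope_numerator k y < 0"
        with slope_numerator_pos_after_nonneg[OF k y] assms False show False by simp
      qed
    qed (use assms in auto)
  qed
  then show ?thesis by (simp add: k_def)
qed

text \<open>Common form of both pairs of bounds, used with \<open>M = A\<close>,
  \<open>N = G\<close> and with \<open>M = Q\<close>, \<open>N = A\<close>. Dividing by
  \<open>M\<close> and taking logarithms leaves the two sign statements about
  \<open>cot_log_diff\<close>.\<close>

lemma exp_mean_bounds:
  fixes M t :: real
  assumes M: "M > 0" and t: "t \<noteq> 0" "\<bar>t\<bar> < pi/2"
    and N: "N = M * cos t" and e: "e = t * cos t / sin t"
  shows "((M + N) / 2) powr (1 / ln 2) * M powr (1 - 1 / ln 2) < M * exp (e - 1)"
    and "M * exp (e - 1) < ((M + N) / 2) powr (4 / 3) * M powr (- 1 / 3)"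
proof -
  \<comment> \<open>Both \<open>t * cos t / sin t\<close> and \<open>cos t\<close> are even, which
    covers negative \<open>t\<close>, that is, \<open>a < b\<close>.\<close>
  have even: "cot_log_diff k \<bar>t\<bar> = e - 1 - k * ln ((1 + cos t) / 2)" for k
    by (simp add: cot_log_diff_def e abs_if)
  have c: "cos t > 0" using t by (intro cos_gt_zero_pi) auto
  have scale: "((M + N) / 2) powr k * M powr (1 - k) = M * exp (k * ln ((1 + cos t) / 2))" for k
  proof -
    have "(M + N) / 2 = M * ((1 + cos t) / 2)" by (simp add: N algebra_simps)
    then have "((M + N) / 2) powr k = M powr k * ((1 + cos t) / 2) powr k"
      using M c by (simp only: powr_mult)
    then have "((M + N) / 2) powr k * M powr (1 - k)
        = (M powr k * M powr (1 - k)) * ((1 + cos t) / 2) powr k"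
      by simp
    also have "M powr k * M powr (1 - k) = M"
      using M by (simp flip: powr_add)
    also have "((1 + cos t) / 2) powr k = exp (k * ln ((1 + cos t) / 2))"
      using c by (simp add: powr_def)
    finally show ?thesis .
  qed
  show "((M + N) / 2) powr (1 / ln 2) * M powr (1 - 1 / ln 2) < M * exp (e - 1)"
    unfolding scale using cot_log_diff_inverse_ln2_pos[of "\<bar>t\<bar>"] t M even[of "1 / ln 2"] by simp
  have "M * exp (e - 1) < M * exp (4/3 * ln ((1 + cos t) / 2))"
    using cot_log_diff_four_thirds_neg[of "\<bar>t\<bar>"] t M even[of "4/3"] by simp
  then show "M * exp (e - 1) < ((M + N) / 2) powr (4 / 3) * M powr (- 1 / 3)"
    using scale[of "4/3"] by simp
qed

theorem proposition2:
  fixes a b A G Q X B :: real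
  assumes "a > 0" and "b > 0" and "a \<noteq> b"
  defines "A \<equiv> arith_mean a b" and "G \<equiv> geom_mean a b" and "Q \<equiv> quadratic_mean a b"
    and "X \<equiv> X_mean a b" and "B \<equiv> B_mean a b"
  shows "((A + G) / 2) powr (1 / ln 2) * A powr (1 - 1 / ln 2) < X
       \<and> X < ((A + G) / 2) powr (4 / 3) * A powr (- 1 / 3)
       \<and> ((Q + A) / 2) powr (1 / ln 2) * Q powr (1 - 1 / ln 2) < B
       \<and> B < ((Q + A) / 2) powr (4 / 3) * Q powr (- 1 / 3)"
proof -
  define v where "v = (a - b) / (a + b)"
  have A: "A > 0" and Av: "2 * A * v = a - b"
    using assms(1,2) by (auto simp: A_def arith_mean_def v_def field_simps)
  have Av': "A * v = (a - b) / 2" using Av by simp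
  have v: "v \<noteq> 0" "-1 < v" "v < 1"
    using assms(1-3) by (auto simp: v_def field_simps)

  have "arcsin v \<noteq> 0" using v sin_arcsin[of v] by fastforce
  moreover have "\<bar>arcsin v\<bar> < pi/2" using arcsin_lt_bounded[of v] v by auto
  \<comment> \<open>With \<open>sin t = v\<close>, this is
    \<open>cos t = sqrt (1 - v\<^sup>2)\<close> combined with
    \<open>a * b = A\<^sup>2 - (A * v)\<^sup>2\<close>.\<close>
  moreover have G: "G = A * cos (arcsin v)"
  proof -
    have "a * b = A\<^sup>2 - (A * v)\<^sup>2"
      unfolding Av' by (simp add: A_def arith_mean_def power2_eq_square field_simps)
    also have "\<dots> = A\<^sup>2 * (1 - v\<^sup>2)" by (simp add: power_mult_distrib algebra_simps)
    finally have "a * b = A\<^sup>2 * (1 - v\<^sup>2)" .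
    then show ?thesis
      using A v by (simp add: G_def geom_mean_def real_sqrt_mult cos_arcsin)
  qed
  moreover have "G / seiffert_mean1 a b = arcsin v * cos (arcsin v) / sin (arcsin v)"
    using A v by (simp add: G seiffert_mean1_def flip: v_def) (simp flip: Av)
  ultimately have 1: "((A + G) / 2) powr (1 / ln 2) * A powr (1 - 1 / ln 2) < X"
      "X < ((A + G) / 2) powr (4 / 3) * A powr (- 1 / 3)"
    using exp_mean_bounds[OF A] by (simp_all add: X_def X_mean_def flip: A_def G_def)

  have Q: "Q > 0"
    using assms(1,2) by (simp add: Q_def quadratic_mean_def add_pos_pos)
  have "\<bar>arctan v\<bar> < pi/2" using arctan_bounded[of v] by auto
  moreover have "arctan v \<noteq> 0" using v by simp
  \<comment> \<open>With \<open>tan t = v\<close>, this is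
    \<open>cos t = 1 / sqrt (1 + v\<^sup>2)\<close>; now \<open>A\<close> is the smaller mean and
    \<open>Q\<close> sets the scale.\<close>
  moreover have cosv: "A = Q * cos (arctan v)"
  proof -
    have "(a\<^sup>2 + b\<^sup>2) / 2 = A\<^sup>2 + (A * v)\<^sup>2"
      unfolding Av' by (simp add: A_def arith_mean_def power2_eq_square field_simps)
    also have "\<dots> = A\<^sup>2 * (1 + v\<^sup>2)" by (simp add: power_mult_distrib algebra_simps)
    finally have "(a\<^sup>2 + b\<^sup>2) / 2 = A\<^sup>2 * (1 + v\<^sup>2)" .
    then have "Q = A * sqrt (1 + v\<^sup>2)"
      using A by (simp add: Q_def quadratic_mean_def real_sqrt_mult)
    moreover have "sqrt (1 + v\<^sup>2) > 0" by (simp add: add_pos_nonneg)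
    ultimately show ?thesis by (simp add: cos_arctan)
  qed
  moreover have "1 + v\<^sup>2 \<noteq> 0" using zero_le_power2[of v] by linarith
  then have "A / seiffert_mean2 a b = arctan v * cos (arctan v) / sin (arctan v)"
    using A v by (simp add: seiffert_mean2_def cos_arctan sin_arctan flip: v_def) (simp flip: Av)
  ultimately have 2: "((Q + A) / 2) powr (1 / ln 2) * Q powr (1 - 1 / ln 2) < B"
      "B < ((Q + A) / 2) powr (4 / 3) * Q powr (- 1 / 3)"
    using exp_mean_bounds[OF Q] by (simp_all add: B_def B_mean_def flip: A_def Q_def)
  show ?thesis using 1 2 by blast
qed

end
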